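(* Let $M$ and $N$ be unital complex Jordan--Banach algebras. The following statements are equivalent: (a) There exists an isometric real-linear Jordan isomorphism from $M$ onto $N$. (b) There exist two clopen quadratic subsets $\mathfrak{M}\subseteq M^{-1}$ and $\mathfrak{N}\subseteq N^{-1}$ (clopen relative to $M^{-1}$ and $N^{-1}$, respectively), which are closed for powers and inverses, and a surjective isometry $\Delta:\mathfrak{M}\to\mathfrak{N}$ satisfying $\Delta(\mathbf{1}_M)=\mathbf{1}_N$ and $\Delta(U_a(b))=U_{\Delta(a)}(\Delta(b))$ for all $a,b\in\mathfrak{M}$. (c) There exists a surjective isometry $\Delta:M^{-1}\to N^{-1}$ satisfying $\Delta(\mathbf{1}_M)=\mathbf{1}_N$ and $\Delta(U_a(b))=U_{\Delta(a)}(\Delta(b))$ for all $a,b\in M^{-1}$. Isometries are with respect to the distances given by the norms.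
   Context: A complex Jordan algebra is a complex vector space $M$ with a commutative bilinear product $\circ$ satisfying $(a\circ b)\circ a^2=a\circ(b\circ a^2)$. A Jordan--Banach algebra is a Jordan algebra with a complete norm satisfying $\|a\circ b\|\le\|a\|\,\|b\|$; if it is unital one also requires $\|\mathbf{1}\|=1$. A real-linear Jordan isomorphism is a real-linear bijection preserving Jordan products. Write $U_a(x)=2(a\circ x)\circ a-a^2\circ x$. An element $a\in M$ is invertible if there is a (necessarily unique) $b=a^{-1}\in M$ with $a\circ b=\mathbf{1}_M$ and $a^2\circ b=a$; $M^{-1}$ is the set of invertible elements. A subset $\mathfrak{M}\subseteq M^{-1}$ is a quadratic subset if it is non-empty and $U_a(b)\in\mathfrak{M}$ for all $a,b\in\mathfrak{M}$. It is closed for powers and inverses if $a^n\in\mathfrak{M}$ (for $n\in\mathbb{N}$) and $a^{-1}\in\mathfrak{M}$ whenever $a\in\mathfrak{M}$. *)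

theory Defs
  imports "HOL-Analysis.Analysis"
begin

class scaleC = scaleR +
  fixes scaleC :: "complex \<Rightarrow> 'a \<Rightarrow> 'a"  (infixr "*\<^sub>C" 75)

class complex_vector = real_vector + scaleC +
  assumes scaleC_add_right: "c *\<^sub>C (x + y) = c *\<^sub>C x + c *\<^sub>C y"
    and scaleC_add_left: "(c + d) *\<^sub>C x = c *\<^sub>C x + d *\<^sub>C x"
    and scaleC_scaleC: "c *\<^sub>C d *\<^sub>C x = (c * d) *\<^sub>C x"
    and scaleC_one: "1 *\<^sub>C x = x"
    and scaleR_scaleC: "r *\<^sub>R x = complex_of_real r *\<^sub>C x"

class complex_jordan_algebra = complex_vector +
  fixes jprod :: "'a \<Rightarrow> 'a \<Rightarrow> 'a"  (infixl "\<bullet>\<^sub>J" 70)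
  assumes jprod_commute: "a \<bullet>\<^sub>J b = b \<bullet>\<^sub>J a"
    and jprod_add_left: "(a + b) \<bullet>\<^sub>J c = a \<bullet>\<^sub>J c + b \<bullet>\<^sub>J c"
    and jprod_scaleC_left: "(z *\<^sub>C a) \<bullet>\<^sub>J b = z *\<^sub>C (a \<bullet>\<^sub>J b)"
    and jordan_identity: "(a \<bullet>\<^sub>J b) \<bullet>\<^sub>J (a \<bullet>\<^sub>J a) = a \<bullet>\<^sub>J (b \<bullet>\<^sub>J (a \<bullet>\<^sub>J a))"

class complex_jordan_banach_algebra = complex_jordan_algebra + banach +
  assumes norm_scaleC: "norm (z *\<^sub>C x) = cmod z * norm x"
    and norm_jprod_le: "norm (a \<bullet>\<^sub>J b) \<le> norm a * norm b"

class unital_complex_jordan_banach_algebra = complex_jordan_banach_algebra + one +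
  assumes one_jprod: "1 \<bullet>\<^sub>J a = a"
    and norm_one_eq_1: "norm 1 = 1"

definition U_op :: "'a::complex_jordan_algebra \<Rightarrow> 'a \<Rightarrow> 'a" where
  "U_op a x = 2 *\<^sub>R ((a \<bullet>\<^sub>J x) \<bullet>\<^sub>J a) - (a \<bullet>\<^sub>J a) \<bullet>\<^sub>J x"

primrec jpower :: "'a::unital_complex_jordan_banach_algebra \<Rightarrow> nat \<Rightarrow> 'a" where
  "jpower a 0 = 1"
| "jpower a (Suc n) = a \<bullet>\<^sub>J jpower a n"

definition is_jinverse :: "'a::unital_complex_jordan_banach_algebra \<Rightarrow> 'a \<Rightarrow> bool" where
  "is_jinverse a b \<longleftrightarrow> a \<bullet>\<^sub>J b = 1 \<and> (a \<bullet>\<^sub>J a) \<bullet>\<^sub>J b = a"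

(* The inverse of an invertible element of a Jordan algebra is unique, so THE denotes
   it there; the value of jinverse at other elements is irrelevant. *)
definition jinverse :: "'a::unital_complex_jordan_banach_algebra \<Rightarrow> 'a" where
  "jinverse a = (THE b. is_jinverse a b)"

definition invertibles :: "'a::unital_complex_jordan_banach_algebra set" where
  "invertibles = {a. \<exists>b. is_jinverse a b}"

definition quadratic_subset :: "'a::unital_complex_jordan_banach_algebra set \<Rightarrow> bool" where
  "quadratic_subset S \<longleftrightarrow>
     S \<subseteq> invertibles \<and> S \<noteq> {} \<and> (\<forall>a\<in>S. \<forall>b\<in>S. U_op a b \<in> S)"

(* Powers are taken with exponent n >= 1. For a quadratic subset closed under these and
   under inverses, the unit is a member anyway: U_op a ((jinverse a)^2) = 1. *)
definition closed_powers_inverses :: "'a::unital_complex_jordan_banach_algebra set \<Rightarrow> bool" where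
  "closed_powers_inverses S \<longleftrightarrow>
     (\<forall>a\<in>S. (\<forall>n\<ge>1. jpower a n \<in> S) \<and> jinverse a \<in> S)"

definition clopen_in :: "'a::topological_space set \<Rightarrow> 'a set \<Rightarrow> bool" where
  "clopen_in X S \<longleftrightarrow> openin (top_of_set X) S \<and> closedin (top_of_set X) S"

definition surjective_isometry ::
    "'a::metric_space set \<Rightarrow> 'b::metric_space set \<Rightarrow> ('a \<Rightarrow> 'b) \<Rightarrow> bool" where
  "surjective_isometry A B f \<longleftrightarrow>
     f ` A = B \<and> (\<forall>x\<in>A. \<forall>y\<in>A. dist (f x) (f y) = dist x y)"

definition preserves_U ::
    "'a::complex_jordan_algebra set \<Rightarrow> ('a \<Rightarrow> 'b::complex_jordan_algebra) \<Rightarrow> bool" where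
  "preserves_U A f \<longleftrightarrow> (\<forall>a\<in>A. \<forall>b\<in>A. f (U_op a b) = U_op (f a) (f b))"

definition real_linear_jordan_isomorphism ::
    "('a::complex_jordan_algebra \<Rightarrow> 'b::complex_jordan_algebra) \<Rightarrow> bool" where
  "real_linear_jordan_isomorphism T \<longleftrightarrow>
     linear T \<and> bij T \<and> (\<forall>x y. T (x \<bullet>\<^sub>J y) = T x \<bullet>\<^sub>J T y)"

end

theory Submission
  imports Defs
begin

text \<open>For (b) \<open>\<Longrightarrow>\<close> (a) only a ball around the unit matters. The quadratic subsets contain
  the unit, and the invertible elements contain the unit ball around it, so \<open>\<Delta>\<close> maps a small ball
  around \<open>1\<close> onto the ball of the same radius. A local version of the Mazur--Ulam theorem gives
  \<open>\<Delta> (1 + x) = 1 + T x\<close> for small \<open>x\<close>, with \<open>T\<close> a surjective real-linear isometry, and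
  \<open>\<Delta> (U\<^sub>a 1) = U\<^bsub>\<Delta> a\<^esub> 1\<close> makes \<open>T\<close> preserve squares. That the set of all invertible elements
  is quadratic, as (c) \<open>\<Longrightarrow>\<close> (b) needs, follows from the fundamental formula
  \<open>U\<^bsub>U\<^sub>a b\<^esub> = U\<^sub>a U\<^sub>b U\<^sub>a\<close>, since \<open>a\<close> is invertible if and only if \<open>U\<^sub>a\<close> is bijective.\<close>

subsection \<open>The fundamental formula\<close>

lemma jprod_add_right: "a \<bullet>\<^sub>J (b + c) = a \<bullet>\<^sub>J b + a \<bullet>\<^sub>J (c :: 'a::complex_jordan_algebra)"
  by (metis jprod_add_left jprod_commute)

lemma jprod_scaleR_left: "(r *\<^sub>R a) \<bullet>\<^sub>J b = r *\<^sub>R (a \<bullet>\<^sub>J (b :: 'a::complex_jordan_algebra))"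
  by (simp add: scaleR_scaleC jprod_scaleC_left)

lemma jprod_scaleR_right: "a \<bullet>\<^sub>J (r *\<^sub>R b) = r *\<^sub>R (a \<bullet>\<^sub>J (b :: 'a::complex_jordan_algebra))"
  by (metis jprod_commute jprod_scaleR_left)

lemma jprod_minus_left: "(- a) \<bullet>\<^sub>J b = - (a \<bullet>\<^sub>J (b :: 'a::complex_jordan_algebra))"
  using jprod_scaleR_left[of "-1" a b] by simp

lemma jprod_diff_left: "(a - b) \<bullet>\<^sub>J c = a \<bullet>\<^sub>J c - b \<bullet>\<^sub>J (c :: 'a::complex_jordan_algebra)"
  using jprod_add_left[of a "- b" c] by (simp add: jprod_minus_left)

lemma jprod_diff_right: "a \<bullet>\<^sub>J (b - c) = a \<bullet>\<^sub>J b - a \<bullet>\<^sub>J (c :: 'a::complex_jordan_algebra)"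
  by (metis jprod_commute jprod_diff_left)

lemmas jprod_linear_simps =
  jprod_add_left jprod_add_right jprod_diff_left jprod_diff_right
  jprod_scaleR_left jprod_scaleR_right

section \<open>The Jordan identity and its full polarisation\<close>

lemma jprod_left_commute_square:
  "a \<bullet>\<^sub>J ((a \<bullet>\<^sub>J a) \<bullet>\<^sub>J b) = (a \<bullet>\<^sub>J a) \<bullet>\<^sub>J (a \<bullet>\<^sub>J (b :: 'a::complex_jordan_algebra))"
  by (metis jordan_identity jprod_commute)

text \<open>Difference of the two sides of the Jordan identity after polarising its cubic variable
  into \<open>a\<close>, \<open>b\<close>, \<open>c\<close>; \<open>d\<close> is the variable that
  was linear from the start. Later identities are checked by expanding them into combinations of
  defects.\<close>

definition jordan_defect :: "'a::complex_jordan_algebra \<Rightarrow> 'a \<Rightarrow> 'a \<Rightarrow> 'a \<Rightarrow> 'a" where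
  "jordan_defect a b c d =
    a \<bullet>\<^sub>J (d \<bullet>\<^sub>J (b \<bullet>\<^sub>J c)) + b \<bullet>\<^sub>J (d \<bullet>\<^sub>J (a \<bullet>\<^sub>J c)) + c \<bullet>\<^sub>J (d \<bullet>\<^sub>J (a \<bullet>\<^sub>J b))
    - (a \<bullet>\<^sub>J d) \<bullet>\<^sub>J (b \<bullet>\<^sub>J c) - (b \<bullet>\<^sub>J d) \<bullet>\<^sub>J (a \<bullet>\<^sub>J c) - (c \<bullet>\<^sub>J d) \<bullet>\<^sub>J (a \<bullet>\<^sub>J b)"

text \<open>\<open>F\<close> vanishes and is cubic in its argument, so inclusion-exclusion over
  \<open>a\<close>, \<open>b\<close>, \<open>c\<close> leaves its fully mixed part. By commutativity
  the six orderings coincide in pairs, whence the factor 2.\<close>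

lemma jordan_defect_eq_0: "jordan_defect a b c d = 0"
proof -
  define F where
    "F x = x \<bullet>\<^sub>J (d \<bullet>\<^sub>J (x \<bullet>\<^sub>J x)) - (x \<bullet>\<^sub>J d) \<bullet>\<^sub>J (x \<bullet>\<^sub>J x)" for x
  have F0: "F x = 0" for x
    by (simp add: F_def jordan_identity)
  have "2 *\<^sub>R jordan_defect a b c d
      = F (a + b + c) - F (a + b) - F (a + c) - F (b + c) + F a + F b + F c"
    unfolding F_def jordan_defect_def scaleR_2 jprod_add_left jprod_add_right
    by (simp add: jprod_commute algebra_simps)
  then show ?thesis
    by (simp add: F0)
qed

section \<open>The Jordan triple product and its identities\<close>

definition jtriple :: "'a::complex_jordan_algebra \<Rightarrow> 'a \<Rightarrow> 'a \<Rightarrow> 'a" where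
  "jtriple x y z = (x \<bullet>\<^sub>J y) \<bullet>\<^sub>J z + x \<bullet>\<^sub>J (y \<bullet>\<^sub>J z) - y \<bullet>\<^sub>J (x \<bullet>\<^sub>J z)"

lemma jtriple_commute: "jtriple x y z = jtriple z y x"
  unfolding jtriple_def by (simp add: jprod_commute algebra_simps)

lemma jtriple_linear_simps:
  "jtriple (x + x') y z = jtriple x y z + jtriple x' y z"
  "jtriple (x - x') y z = jtriple x y z - jtriple x' y z"
  "jtriple x (y + y') z = jtriple x y z + jtriple x y' z"
  "jtriple x (y - y') z = jtriple x y z - jtriple x y' z"
  "jtriple x y (z + z') = jtriple x y z + jtriple x y z'"
  "jtriple x y (z - z') = jtriple x y z - jtriple x y z'"
  unfolding jtriple_def by (simp_all add: jprod_linear_simps)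

lemma U_op_eq_jtriple: "U_op x y = jtriple x y x"
  unfolding U_op_def jtriple_def scaleR_2 by (simp add: jprod_commute)

lemma U_op_linear_simps:
  "U_op x (y + z) = U_op x y + U_op x z"
  "U_op x (y - z) = U_op x y - U_op x z"
  by (simp_all add: U_op_eq_jtriple jtriple_linear_simps)

text \<open>Subtracting two polarised Jordan identities with \<open>x\<close> and \<open>y\<close>
  interchanged cancels all products of two products; the Leibniz rule for the commutator of the two
  multiplications remains.\<close>

lemma jprod_commutator_derivation:
  fixes x y :: "'a::complex_jordan_algebra"
  defines "d \<equiv> \<lambda>w. x \<bullet>\<^sub>J (y \<bullet>\<^sub>J w) - y \<bullet>\<^sub>J (x \<bullet>\<^sub>J w)"
  shows "d (u \<bullet>\<^sub>J v) = d u \<bullet>\<^sub>J v + u \<bullet>\<^sub>J d v"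
proof -
  have "d (u \<bullet>\<^sub>J v) - (d u \<bullet>\<^sub>J v + u \<bullet>\<^sub>J d v) = jordan_defect x u v y - jordan_defect y u v x"
    unfolding d_def jordan_defect_def jprod_linear_simps by (simp add: jprod_commute algebra_simps)
  then show ?thesis
    by (simp add: jordan_defect_eq_0)
qed

lemma jtriple_commutator_derivation:
  fixes x y :: "'a::complex_jordan_algebra"
  defines "d \<equiv> \<lambda>w. x \<bullet>\<^sub>J (y \<bullet>\<^sub>J w) - y \<bullet>\<^sub>J (x \<bullet>\<^sub>J w)"
  shows "d (jtriple u v z) = jtriple (d u) v z + jtriple u (d v) z + jtriple u v (d z)"
proof -
  have der: "d (a \<bullet>\<^sub>J b) = d a \<bullet>\<^sub>J b + a \<bullet>\<^sub>J d b" for a b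
    unfolding d_def by (rule jprod_commutator_derivation)
  have "d (a + b) = d a + d b" "d (a - b) = d a - d b" for a b
    unfolding d_def by (simp_all add: jprod_linear_simps)
  then show ?thesis
    unfolding jtriple_def by (simp add: der jprod_linear_simps)
qed

text \<open>A combination of three polarised identities. In contrast to the commutators above, the
  middle slot enters with a minus sign; \<open>jtriple_jtriple\<close> relies on this sign.\<close>

lemma jprod_jtriple:
  fixes a :: "'a::complex_jordan_algebra"
  shows "a \<bullet>\<^sub>J jtriple u v z
    = jtriple (a \<bullet>\<^sub>J u) v z - jtriple u (a \<bullet>\<^sub>J v) z + jtriple u v (a \<bullet>\<^sub>J z)"
    (is "?l = ?r")
proof -
  have "?l - ?r = jordan_defect a u v z + jordan_defect a v z u - jordan_defect a u z v"
    unfolding jtriple_def jordan_defect_def jprod_linear_simps by (simp add: jprod_commute algebra_simps)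
  then show ?thesis
    by (simp add: jordan_defect_eq_0)
qed

text \<open>The main identity of Jordan triple systems. \<open>jtriple x y\<close> is multiplication
  by \<open>x \<bullet>\<^sub>J y\<close> plus the commutator \<open>d\<close>, and
  \<open>jtriple y x\<close> is the same multiplication minus \<open>d\<close>. Adding the rules for
  the two parts gives the claim, the minus sign in the middle slot turning into the swap of
  \<open>x\<close> and \<open>y\<close>.\<close>

lemma jtriple_jtriple:
  "jtriple x y (jtriple u v z)
    = jtriple (jtriple x y u) v z - jtriple u (jtriple y x v) z + jtriple u v (jtriple x y z)"
proof -
  define d where "d w = x \<bullet>\<^sub>J (y \<bullet>\<^sub>J w) - y \<bullet>\<^sub>J (x \<bullet>\<^sub>J w)" for w
  have xy: "jtriple x y w = (x \<bullet>\<^sub>J y) \<bullet>\<^sub>J w + d w" for w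
    by (simp add: jtriple_def d_def)
  have yx: "jtriple y x w = (x \<bullet>\<^sub>J y) \<bullet>\<^sub>J w - d w" for w
    by (simp add: jtriple_def d_def jprod_commute)
  have "d (jtriple u v z) = jtriple (d u) v z + jtriple u (d v) z + jtriple u v (d z)"
    unfolding d_def by (rule jtriple_commutator_derivation)
  with jprod_jtriple[of "x \<bullet>\<^sub>J y" u v z] show ?thesis
    unfolding xy yx jtriple_linear_simps by simp
qed

text \<open>Let A and B be the two sides. With \<open>x\<close> in both outer slots the main
  identity reads A = 2 B - C, where C = \<open>U_op x (jtriple y x v)\<close> is symmetric in
  \<open>y\<close> and \<open>v\<close>. Interchanging them gives B = 2 A - C, and subtraction gives
  3 (A - B) = 0.\<close>

lemma jtriple_U_op_exchange: "jtriple x y (U_op x v) = jtriple x v (U_op x y)"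
proof -
  have yv: "jtriple x y (U_op x v) = 2 *\<^sub>R jtriple x v (U_op x y) - U_op x (jtriple y x v)" for y v
    unfolding U_op_eq_jtriple
    using jtriple_jtriple[of x y x v x] jtriple_commute[of "jtriple x y x" v x]
    by (simp add: scaleR_2)
  let ?A = "jtriple x y (U_op x v)" and ?B = "jtriple x v (U_op x y)"
  have "2 *\<^sub>R (?A - ?B) + (?A - ?B) = (?A - (2 *\<^sub>R ?B - U_op x (jtriple y x v)))
      - (?B - (2 *\<^sub>R ?A - U_op x (jtriple y x v)))"
    by (simp add: algebra_simps)
  also have "\<dots> = 0"
    using yv[of y v] yv[of v y] jtriple_commute[of y x v] by simp
  finally have "3 *\<^sub>R (?A - ?B) = 0"
    using scaleR_add_left[of 2 1 "?A - ?B"] by simp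
  then show ?thesis
    by simp
qed

lemma jtriple_U_op: "jtriple x y (U_op x v) = U_op x (jtriple y x v)"
proof -
  have "2 *\<^sub>R jtriple x y (U_op x v) = jtriple x y (U_op x v) + U_op x (jtriple y x v)"
    using jtriple_jtriple[of x y x v x] jtriple_commute[of "jtriple x y x" v x]
      jtriple_U_op_exchange[of x y v]
    by (simp add: scaleR_2 U_op_eq_jtriple)
  then show ?thesis
    by (simp add: scaleR_2)
qed

text \<open>Expanding \<open>jtriple z x (U_op y x)\<close> by the main identity produces
  \<open>U_op y (U_op x z)\<close> as the middle term, for which the equation is solved.\<close>

lemma U_op_U_op:
  "U_op y (U_op x z) = 2 *\<^sub>R jtriple y x (jtriple y x z) - jtriple (U_op y x) x z"
  using jtriple_jtriple[of z x y x y] jtriple_commute[of z x "U_op y x"]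
    jtriple_commute[of "jtriple z x y" x y] jtriple_commute[of z x y]
  by (simp add: U_op_eq_jtriple scaleR_2 algebra_simps)

text \<open>Writing one outer \<open>p\<close> of \<open>jtriple p z p\<close> as
  \<open>jtriple x y x\<close> and applying the main identity gives three triple products. Each is
  \<open>U_op x\<close> of some element by \<open>jtriple_U_op\<close>, and the sum of these
  elements is the expression for \<open>U_op y (U_op x z)\<close> from
  \<open>U_op_U_op\<close>.\<close>

theorem U_op_fundamental_formula: "U_op (U_op x y) z = U_op x (U_op y (U_op x z))"
proof -
  define p where "p = U_op x y"
  define w where "w = jtriple y x z"
  have xzp: "jtriple x z p = U_op x w"
    unfolding p_def w_def jtriple_U_op_exchange[of x z y] by (rule jtriple_U_op)
  have xyp: "jtriple x y p = U_op x (U_op y x)"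
    unfolding p_def jtriple_U_op by (simp add: U_op_eq_jtriple)
  have "U_op p z = jtriple x y (jtriple x z p) + jtriple x w p - jtriple x z (jtriple x y p)"
    unfolding w_def U_op_eq_jtriple[of p z]
    using jtriple_jtriple[of x y x z p] by (simp add: p_def U_op_eq_jtriple)
  also have "\<dots> = U_op x (jtriple y x w) + U_op x (jtriple y x w) - U_op x (jtriple (U_op y x) x z)"
    unfolding xzp xyp unfolding p_def jtriple_U_op
    by (simp add: jtriple_commute[of w] jtriple_commute[of z])
  also have "\<dots> = U_op x (2 *\<^sub>R jtriple y x w - jtriple (U_op y x) x z)"
    by (simp add: U_op_linear_simps scaleR_2)
  finally show ?thesis
    unfolding p_def w_def U_op_U_op .
qed

subsection \<open>Invertible elements\<close>

lemma jprod_one: "a \<bullet>\<^sub>J 1 = (a :: 'a::unital_complex_jordan_banach_algebra)"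
  by (metis jprod_commute one_jprod)

lemma U_op_1_left: "U_op 1 x = (x :: 'a::unital_complex_jordan_banach_algebra)"
  by (simp add: U_op_def one_jprod jprod_one scaleR_2)

lemma U_op_1_right: "U_op x 1 = x \<bullet>\<^sub>J (x :: 'a::unital_complex_jordan_banach_algebra)"
  by (simp add: U_op_def jprod_one scaleR_2)

lemma U_op_left: "U_op a x = 2 *\<^sub>R (a \<bullet>\<^sub>J (a \<bullet>\<^sub>J x)) - (a \<bullet>\<^sub>J a) \<bullet>\<^sub>J (x :: 'a::complex_jordan_algebra)"
  unfolding U_op_def by (simp only: jprod_commute[of "a \<bullet>\<^sub>J x" a])

text \<open>\<open>U_op a\<close> is built from the multiplications by \<open>a\<close> and by its
  square, and these commute.\<close>

lemma U_op_jprod: "U_op a (a \<bullet>\<^sub>J x) = a \<bullet>\<^sub>J U_op a (x :: 'a::complex_jordan_algebra)"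
  unfolding U_op_left jprod_diff_right jprod_scaleR_right jprod_left_commute_square ..

text \<open>For the second equation, two polarised Jordan identities in \<open>a\<close> and
  \<open>b\<close> show that multiplying the square of \<open>b\<close> twice by \<open>a\<close>,
  or once by the square of \<open>a\<close>, gives 1 in both cases; then \<open>U_op\<close> yields
  2 - 1.\<close>

lemma is_jinverse_U_op:
  assumes "is_jinverse a b"
  shows "U_op a b = a" and "U_op a (b \<bullet>\<^sub>J b) = 1"
proof -
  have ab: "a \<bullet>\<^sub>J b = 1" and aab: "(a \<bullet>\<^sub>J a) \<bullet>\<^sub>J b = a"
    using assms by (auto simp: is_jinverse_def)
  show "U_op a b = a"
    by (simp add: U_op_def ab aab one_jprod scaleR_2)
  have ba: "b \<bullet>\<^sub>J a = 1" and baa: "b \<bullet>\<^sub>J (a \<bullet>\<^sub>J a) = a"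
    using ab aab by (simp_all only: jprod_commute)
  have "a \<bullet>\<^sub>J (a \<bullet>\<^sub>J (b \<bullet>\<^sub>J b)) = (a \<bullet>\<^sub>J a) \<bullet>\<^sub>J (b \<bullet>\<^sub>J b)"
    using jordan_defect_eq_0[of a b b a] by (simp add: jordan_defect_def ab ba jprod_one one_jprod)
  moreover have "(b \<bullet>\<^sub>J b) \<bullet>\<^sub>J (a \<bullet>\<^sub>J a) = 1"
    using jordan_defect_eq_0[of b a a b]
    by (simp add: jordan_defect_def ab ba baa jprod_one one_jprod)
  then have "(a \<bullet>\<^sub>J a) \<bullet>\<^sub>J (b \<bullet>\<^sub>J b) = 1"
    by (simp only: jprod_commute)
  ultimately show "U_op a (b \<bullet>\<^sub>J b) = 1"
    by (simp add: U_op_left scaleR_2)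
qed

text \<open>Since \<open>U_op a (b \<bullet>\<^sub>J b) = 1\<close>, the fundamental formula makes
  \<open>U_op a\<close>, \<open>U_op (b \<bullet>\<^sub>J b)\<close>, \<open>U_op a\<close> compose
  to the identity. So \<open>U_op a\<close> has a left and a right inverse.\<close>

lemma bij_U_op_if_is_jinverse:
  assumes "is_jinverse a b"
  shows "bij (U_op a)"
proof -
  have inv: "U_op a (U_op (b \<bullet>\<^sub>J b) (U_op a x)) = x" for x
    by (simp only: is_jinverse_U_op(2)[OF assms] U_op_1_left flip: U_op_fundamental_formula)
  have "inj (U_op a)"
  proof (rule injI)
    fix x y assume "U_op a x = U_op a y"
    then have "U_op a (U_op (b \<bullet>\<^sub>J b) (U_op a x)) = U_op a (U_op (b \<bullet>\<^sub>J b) (U_op a y))"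
      by (rule arg_cong)
    then show "x = y"
      unfolding inv .
  qed
  moreover have "surj (U_op a)"
    by (rule surjI) (rule inv)
  ultimately show ?thesis
    by (simp add: bij_def)
qed

text \<open>\<open>U_op a\<close> commutes with multiplication by \<open>a\<close>, so it sends
  \<open>a \<bullet>\<^sub>J b\<close> and 1 to the same square. Injectivity gives the first
  equation for an inverse, and the definition of \<open>U_op\<close> then gives the second.\<close>

lemma is_jinverse_if_U_op:
  assumes "inj (U_op a)" and b: "U_op a b = a"
  shows "is_jinverse a b"
proof -
  have "U_op a (a \<bullet>\<^sub>J b) = U_op a 1"
    by (simp add: U_op_jprod b U_op_1_right)
  then have "a \<bullet>\<^sub>J b = 1"
    using assms(1) by (simp add: inj_eq)
  moreover from this have "U_op a b = a + a - (a \<bullet>\<^sub>J a) \<bullet>\<^sub>J b"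
    by (simp add: U_op_def one_jprod scaleR_2)
  then have "(a \<bullet>\<^sub>J a) \<bullet>\<^sub>J b = a"
    unfolding b by (metis add_diff_cancel_left' diff_diff_eq2 add_diff_cancel_right')
  ultimately show ?thesis
    by (simp add: is_jinverse_def)
qed

lemma invertibles_iff_bij_U_op: "a \<in> invertibles \<longleftrightarrow> bij (U_op a)"
proof
  assume "bij (U_op a)"
  then have "inj (U_op a)" and "\<exists>b. U_op a b = a"
    by (auto simp: bij_def) (metis surjD)
  then show "a \<in> invertibles"
    using is_jinverse_if_U_op by (auto simp: invertibles_def)
qed (auto simp: invertibles_def bij_U_op_if_is_jinverse)

text \<open>Uniqueness: every inverse solves \<open>U_op a b = a\<close>, and \<open>U_op a\<close>
  is injective.\<close>

lemma is_jinverse_jinverse: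
  assumes "a \<in> invertibles"
  shows "is_jinverse a (jinverse a)"
  unfolding jinverse_def
proof (rule theI')
  have "b = c" if "is_jinverse a b" "is_jinverse a c" for b c
    using that bij_U_op_if_is_jinverse is_jinverse_U_op(1) by (metis bij_is_inj injD)
  with assms show "\<exists>!b. is_jinverse a b"
    by (auto simp: invertibles_def)
qed

lemma U_op_invertibles:
  assumes "a \<in> invertibles" "b \<in> invertibles"
  shows "U_op a b \<in> invertibles"
proof -
  have "U_op (U_op a b) = U_op a \<circ> U_op b \<circ> U_op a"
    by (auto simp: U_op_fundamental_formula)
  with assms show ?thesis
    unfolding invertibles_iff_bij_U_op by (simp add: bij_comp comp_assoc)
qed

text \<open>The inverse relation is symmetric. Its missing half,
  \<open>a \<bullet>\<^sub>J (?b \<bullet>\<^sub>J ?b) = ?b\<close>, is checked after applying the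
  injective map \<open>U_op a\<close>, which sends both sides to \<open>a\<close>.\<close>

lemma jinverse_invertibles:
  assumes "a \<in> invertibles"
  shows "jinverse a \<in> invertibles"
proof -
  let ?b = "jinverse a"
  have b: "is_jinverse a ?b"
    using assms by (rule is_jinverse_jinverse)
  have "U_op a (a \<bullet>\<^sub>J (?b \<bullet>\<^sub>J ?b)) = U_op a ?b"
    unfolding U_op_jprod is_jinverse_U_op[OF b] by (simp add: jprod_one)
  then have "a \<bullet>\<^sub>J (?b \<bullet>\<^sub>J ?b) = ?b"
    using bij_is_inj[OF bij_U_op_if_is_jinverse[OF b]] by (simp only: inj_eq)
  moreover have "a \<bullet>\<^sub>J ?b = 1"
    using b by (simp add: is_jinverse_def)
  ultimately have "is_jinverse ?b a"
    unfolding is_jinverse_def by (simp only: jprod_commute)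
  then show ?thesis
    by (auto simp: invertibles_def)
qed

lemma jprod_square_jpower: "(a \<bullet>\<^sub>J a) \<bullet>\<^sub>J jpower a n = jpower a (Suc (Suc n))"
proof (induction n)
  case (Suc n)
  then show ?case
    using jprod_left_commute_square[of a "jpower a n"] by simp
qed (simp add: jprod_one)

lemma U_op_jpower: "U_op a (jpower a n) = jpower a (Suc (Suc n))"
  unfolding U_op_def jprod_square_jpower by (simp add: scaleR_2 jprod_commute)

lemma one_invertibles: "1 \<in> invertibles"
  by (auto simp: invertibles_def is_jinverse_def one_jprod)

text \<open>\<open>U_op a\<close> raises the exponent by two, hence the two-step induction.\<close>

lemma jpower_invertibles:
  assumes "a \<in> invertibles"
  shows "jpower a n \<in> invertibles"
proof (induction n rule: induct_nat_012)
  case 1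
  then show ?case using assms by (simp add: jprod_one)
next
  case (ge2 n)
  then show ?case
    using U_op_invertibles[OF assms ge2(1)] by (simp only: U_op_jpower)
qed (simp add: one_invertibles)

lemma one_in_quadratic_subset:
  assumes "quadratic_subset S" "closed_powers_inverses S"
  shows "1 \<in> S"
proof -
  obtain a where a: "a \<in> S" "a \<in> invertibles"
    using assms(1) unfolding quadratic_subset_def by blast
  let ?b = "jinverse a"
  have "jpower ?b 2 \<in> S"
    using assms(2) a(1) by (simp add: closed_powers_inverses_def)
  then have "U_op a (?b \<bullet>\<^sub>J ?b) \<in> S"
    using assms(1) a(1) unfolding quadratic_subset_def numeral_2_eq_2 by (simp add: jprod_one)
  then show ?thesis
    using is_jinverse_U_op(2)[OF is_jinverse_jinverse[OF a(2)]] by simp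
qed

section \<open>The Neumann series and a ball of invertible elements\<close>

lemma norm_jpower_le: "norm (jpower a n) \<le> norm a ^ n"
proof (induction n)
  case (Suc n)
  have "norm (jpower a (Suc n)) \<le> norm a * norm (jpower a n)"
    by (simp add: norm_jprod_le)
  also have "\<dots> \<le> norm a * norm a ^ n"
    using Suc by (rule mult_left_mono) simp
  finally show ?case by simp
qed (simp add: norm_one_eq_1)

lemma bounded_linear_jprod_right:
  "bounded_linear (\<lambda>x. a \<bullet>\<^sub>J (x :: 'a::unital_complex_jordan_banach_algebra))"
  by (rule bounded_linear_intro[where K = "norm a"])
    (auto simp: jprod_linear_simps norm_jprod_le mult.commute[of _ "norm a"])

lemma one_minus_invertibles:
  fixes x :: "'a::unital_complex_jordan_banach_algebra"
  assumes "norm x < 1"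
  shows "1 - x \<in> invertibles"
proof -
  define b where "b = (\<Sum>n. jpower x n)"
  have sum: "summable (jpower x)"
    by (rule summable_comparison_test'[where g = "\<lambda>n. norm x ^ n" and N = 0])
      (use assms in \<open>auto simp: norm_jpower_le summable_geometric\<close>)
  have xb: "x \<bullet>\<^sub>J b = b - 1"
  proof -
    have "x \<bullet>\<^sub>J b = (\<Sum>n. jpower x (Suc n))"
      using bounded_linear.suminf[OF bounded_linear_jprod_right[of x] sum]
      by (simp add: b_def)
    then show ?thesis
      using suminf_split_head[OF sum] by (simp add: b_def)
  qed
  \<comment> \<open>Without associativity this cannot be read off from \<open>xb\<close>. The square
    of \<open>x\<close> acts like two multiplications by \<open>x\<close> on each power of
    \<open>x\<close>, hence termwise on the series.\<close>
  have "(x \<bullet>\<^sub>J x) \<bullet>\<^sub>J b = (\<Sum>n. (x \<bullet>\<^sub>J x) \<bullet>\<^sub>J jpower x n)"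
    using bounded_linear.suminf[OF bounded_linear_jprod_right sum] by (simp add: b_def)
  also have "\<dots> = (\<Sum>n. x \<bullet>\<^sub>J (x \<bullet>\<^sub>J jpower x n))"
    unfolding jprod_square_jpower by simp
  also have "\<dots> = x \<bullet>\<^sub>J (\<Sum>n. x \<bullet>\<^sub>J jpower x n)"
    using bounded_linear.suminf[OF bounded_linear_jprod_right
        bounded_linear.summable[OF bounded_linear_jprod_right sum]] by simp
  also have "(\<Sum>n. x \<bullet>\<^sub>J jpower x n) = x \<bullet>\<^sub>J b"
    using bounded_linear.suminf[OF bounded_linear_jprod_right sum] by (simp add: b_def)
  finally have xxb: "(x \<bullet>\<^sub>J x) \<bullet>\<^sub>J b = b - 1 - x"
    by (simp add: xb jprod_linear_simps jprod_one)
  have "is_jinverse (1 - x) b"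
    by (simp add: is_jinverse_def jprod_linear_simps one_jprod jprod_one xb xxb)
  then show ?thesis
    by (auto simp: invertibles_def)
qed

lemma ball_1_subset_invertibles: "ball 1 1 \<subseteq> invertibles"
proof
  fix a :: 'a assume "a \<in> ball 1 1"
  then show "a \<in> invertibles"
    using one_minus_invertibles[of "1 - a"] by (simp add: dist_norm)
qed

text \<open>Relative openness gives a genuine ball because the unit ball around 1 consists of
  invertible elements.\<close>

lemma ball_subset_if_openin_invertibles:
  assumes "openin (top_of_set invertibles) S" "1 \<in> S"
  shows "\<exists>r>0. ball 1 r \<subseteq> S"
proof -
  obtain T where T: "open T" "S = invertibles \<inter> T"
    using assms(1) by (auto simp: openin_open)
  then obtain r where "r > 0" "ball 1 r \<subseteq> T"
    using assms(2) open_contains_ball by blast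
  then have "ball 1 (min r 1) \<subseteq> S"
    using T(2) ball_1_subset_invertibles subset_ball[of "min r 1" r 1] subset_ball[of "min r 1" 1 1]
    by (auto simp: subset_iff)
  with \<open>r > 0\<close> show ?thesis
    by (intro exI[of _ "min r 1"]) auto
qed

subsection \<open>A local Mazur--Ulam theorem\<close>

lemma surjective_isometry_mem: "surjective_isometry A B f \<Longrightarrow> x \<in> A \<Longrightarrow> f x \<in> B"
  by (auto simp: surjective_isometry_def)

lemma surjective_isometry_comp:
  "surjective_isometry A B f \<Longrightarrow> surjective_isometry B C g \<Longrightarrow> surjective_isometry A C (g \<circ> f)"
  unfolding surjective_isometry_def by (auto simp: image_comp [symmetric])

lemma surjective_isometry_inv_into:
  assumes "surjective_isometry A B f"
  shows "surjective_isometry B A (inv_into A f)"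
    and "\<And>x. x \<in> A \<Longrightarrow> inv_into A f (f x) = x"
    and "\<And>y. y \<in> B \<Longrightarrow> f (inv_into A f y) = y"
proof -
  have B: "f ` A = B" and iso: "\<And>x y. x \<in> A \<Longrightarrow> y \<in> A \<Longrightarrow> dist (f x) (f y) = dist x y"
    using assms by (auto simp: surjective_isometry_def)
  have inj: "inj_on f A"
    by (metis dist_eq_0_iff inj_onI iso)
  show left: "inv_into A f (f x) = x" if "x \<in> A" for x
    using inj that by simp
  show "f (inv_into A f y) = y" if "y \<in> B" for y
    using that B by (simp add: f_inv_into_f)
  show "surjective_isometry B A (inv_into A f)"
    unfolding surjective_isometry_def
  proof (intro conjI ballI)
    show "inv_into A f ` B = A"
      unfolding B [symmetric] image_image using left by simp
    show "dist (inv_into A f u) (inv_into A f v) = dist u v" if "u \<in> B" "v \<in> B" for u v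
    proof -
      obtain x y where "x \<in> A" "y \<in> A" "u = f x" "v = f y"
        using \<open>u \<in> B\<close> \<open>v \<in> B\<close> unfolding B [symmetric] by blast
      then show ?thesis
        by (simp only: left iso)
    qed
  qed
qed

lemma surjective_isometry_point_reflection:
  fixes A :: "'a::real_normed_vector set"
  assumes "\<And>w. w \<in> A \<Longrightarrow> c - w \<in> A"
  shows "surjective_isometry A A (\<lambda>w. c - w)"
proof -
  have "w \<in> (\<lambda>w. c - w) ` A" if "w \<in> A" for w
    using assms[OF that] by (intro image_eqI[of _ _ "c - w"]) auto
  with assms show ?thesis
    unfolding surjective_isometry_def
    by (auto simp: dist_norm norm_minus_commute)
qed

text \<open>Vaisala's doubling argument: composing a counterexample with its conjugate under the
  reflection in the midpoint doubles the displacement of the midpoint.\<close>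

lemma isometry_fixes_midpoint:
  fixes A :: "'a::real_normed_vector set"
  assumes "bounded A" and x: "x \<in> A" and y: "y \<in> A" and z: "midpoint x y \<in> A"
    and sym: "\<And>w. w \<in> A \<Longrightarrow> x + y - w \<in> A"
    and "surjective_isometry A A g" "g x = x" "g y = y"
  shows "g (midpoint x y) = midpoint x y"
proof (rule ccontr)
  let ?z = "midpoint x y" and ?r = "\<lambda>w. x + y - w"
  assume nz: "g ?z \<noteq> ?z"
  obtain K where K: "\<And>u v. u \<in> A \<Longrightarrow> v \<in> A \<Longrightarrow> dist u v \<le> K"
    using \<open>bounded A\<close> unfolding bounded_two_points by blast
  have refl: "surjective_isometry A A ?r"
    by (rule surjective_isometry_point_reflection) (rule sym)
  have zz: "?r ?z = ?z"
    by (simp add: midpoint_def algebra_simps flip: scaleR_add_left)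
  have doubling: "\<exists>h. surjective_isometry A A h \<and> h x = x \<and> h y = y \<and>
      2 ^ n * dist (g ?z) ?z \<le> dist (h ?z) ?z" for n
  proof (induction n)
    case 0
    show ?case using assms(6-8) by (intro exI[of _ g]) simp
  next
    case (Suc n)
    then obtain h where h: "surjective_isometry A A h" "h x = x" "h y = y"
      and le: "2 ^ n * dist (g ?z) ?z \<le> dist (h ?z) ?z" by blast
    let ?h' = "inv_into A h"
    note inv = surjective_isometry_inv_into[OF h(1)]
    have fixed: "?h' x = x" "?h' y = y"
      using inv(2)[OF x] inv(2)[OF y] h by auto
    \<comment> \<open>The reflection swaps \<open>x\<close> and \<open>y\<close>, which
      \<open>h\<close> and its inverse fix, so \<open>?k\<close> fixes both again.\<close>
    let ?k = "?r \<circ> ?h' \<circ> ?r \<circ> h"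
    have k: "surjective_isometry A A ?k"
      by (intro surjective_isometry_comp[OF h(1)] surjective_isometry_comp[OF refl]
          surjective_isometry_comp[OF inv(1)] refl)
    have hz: "h ?z \<in> A" using h(1) z by (rule surjective_isometry_mem)
    have "dist (?k ?z) ?z = dist (?r (?h' (?r (h ?z)))) (?r ?z)"
      by (simp add: zz)
    also have "\<dots> = dist (?h' (?r (h ?z))) (?h' (h ?z))"
      by (simp add: inv(2)[OF z] dist_norm norm_minus_commute)
    also have "\<dots> = dist (?r (h ?z)) (h ?z)"
      using inv(1) sym[OF hz] hz by (simp add: surjective_isometry_def)
    also have "\<dots> = 2 * dist (h ?z) ?z"
    proof -
      have "?r (h ?z) - h ?z = 2 *\<^sub>R (?z - h ?z)"
        by (simp add: midpoint_def algebra_simps scaleR_2)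
      then show ?thesis by (simp add: dist_norm norm_minus_commute)
    qed
    finally have "2 ^ Suc n * dist (g ?z) ?z \<le> dist (?k ?z) ?z"
      using le by simp
    moreover have "?k x = x" "?k y = y"
      by (simp_all add: h fixed)
    ultimately show ?case
      using k by blast
  qed
  have bound: "2 ^ n * dist (g ?z) ?z \<le> K" for n
  proof -
    obtain h where h: "surjective_isometry A A h" "2 ^ n * dist (g ?z) ?z \<le> dist (h ?z) ?z"
      using doubling by blast
    have "dist (h ?z) ?z \<le> K"
      using surjective_isometry_mem[OF h(1) z] z by (rule K)
    with h(2) show ?thesis by (rule order_trans)
  qed
  have pos: "0 < dist (g ?z) ?z" using nz by simp
  obtain n where "K / dist (g ?z) ?z < 2 ^ n"
    using real_arch_pow[of 2] by auto
  with pos have "K < 2 ^ n * dist (g ?z) ?z" by (simp add: field_simps)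
  with bound[of n] show False by simp
qed

text \<open>Going through \<open>f\<close>, the reflection in the target, \<open>f\<close> backwards
  and the reflection in the source is an isometry of \<open>A\<close> fixing \<open>x\<close> and
  \<open>y\<close>, so it fixes their midpoint. Hence the image of the midpoint is fixed by the
  target reflection, whose only fixed point is the midpoint of the images.\<close>

lemma surjective_isometry_midpoint:
  fixes f :: "'a::real_normed_vector \<Rightarrow> 'b::real_normed_vector"
  assumes f: "surjective_isometry A B f" and "bounded A"
    and x: "x \<in> A" and y: "y \<in> A" and z: "midpoint x y \<in> A"
    and symA: "\<And>w. w \<in> A \<Longrightarrow> x + y - w \<in> A"
    and symB: "\<And>w. w \<in> B \<Longrightarrow> f x + f y - w \<in> B"
  shows "f (midpoint x y) = midpoint (f x) (f y)"
proof -
  let ?z = "midpoint x y" and ?r = "\<lambda>w. x + y - w" and ?s = "\<lambda>w. f x + f y - w"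
  let ?f' = "inv_into A f"
  note inv = surjective_isometry_inv_into[OF f]
  have fz: "f ?z \<in> B" using f z by (rule surjective_isometry_mem)
  have sfz: "?s (f ?z) \<in> B" by (rule symB[OF fz])
  have rA: "surjective_isometry A A ?r" and rB: "surjective_isometry B B ?s"
    by (rule surjective_isometry_point_reflection, fact symA)
      (rule surjective_isometry_point_reflection, fact symB)
  let ?h = "?r \<circ> ?f' \<circ> ?s \<circ> f"
  have "?h ?z = ?z"
  proof (rule isometry_fixes_midpoint[OF \<open>bounded A\<close> x y z symA])
    show "surjective_isometry A A ?h"
      by (intro surjective_isometry_comp[OF f] surjective_isometry_comp[OF rB]
          surjective_isometry_comp[OF inv(1)] rA)
  qed (use inv(2) x y in auto)
  then have "?f' (?s (f ?z)) = x + y - ?z"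
    by (simp add: algebra_simps)
  also have "\<dots> = ?z"
    by (simp add: midpoint_def algebra_simps flip: scaleR_add_left)
  finally have "?s (f ?z) = f ?z"
    using inv(3)[OF sfz] by simp
  then have "f x + f y = 2 *\<^sub>R f ?z"
    by (simp add: scaleR_2 algebra_simps)
  then show ?thesis
    by (simp add: midpoint_def[of "f x"])
qed

text \<open>Additivity gives integer homogeneity. Splitting \<open>real n * t\<close> into integer
  and fractional part bounds \<open>n\<close> times the error at \<open>t\<close> by
  \<open>2 * norm x\<close>, for every \<open>n\<close>; so the error is zero.\<close>

lemma additive_contraction_imp_linear:
  fixes T :: "'a::real_normed_vector \<Rightarrow> 'b::real_normed_vector"
  assumes add: "\<And>x y. T (x + y) = T x + T y" and le: "\<And>x. norm (T x) \<le> norm x"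
  shows "linear T"
proof (rule linearI)
  have T0: "T 0 = 0"
    using add[of 0 0] by simp
  have minus: "T (- x) = - T x" for x
    by (rule minus_unique [symmetric]) (simp add: T0 flip: add)
  have nat: "T (real n *\<^sub>R x) = real n *\<^sub>R T x" for n x
    by (induction n) (simp_all add: T0 add scaleR_add_left)
  have int: "T (of_int m *\<^sub>R x) = of_int m *\<^sub>R T x" for m x
    by (cases m rule: int_cases2) (auto simp: nat minus)
  show "T (t *\<^sub>R x) = t *\<^sub>R T x" for t x
  proof -
    have bound: "real n * norm (T (t *\<^sub>R x) - t *\<^sub>R T x) \<le> 2 * norm x" for n
    proof -
      let ?m = "of_int \<lfloor>real n * t\<rfloor> :: real"
      let ?e = "real n * t - ?m"
      have e: "\<bar>?e\<bar> \<le> 1" by linarith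
      have "real n *\<^sub>R (T (t *\<^sub>R x) - t *\<^sub>R T x) = T ((?e + ?m) *\<^sub>R x) - (?e + ?m) *\<^sub>R T x"
        using nat[of n "t *\<^sub>R x"] by (simp add: scaleR_diff_right)
      also have "\<dots> = T (?e *\<^sub>R x) - ?e *\<^sub>R T x"
        unfolding scaleR_add_left add int by simp
      finally have "norm (real n *\<^sub>R (T (t *\<^sub>R x) - t *\<^sub>R T x)) = norm (T (?e *\<^sub>R x) - ?e *\<^sub>R T x)"
        by (rule arg_cong)
      then have "real n * norm (T (t *\<^sub>R x) - t *\<^sub>R T x) = norm (T (?e *\<^sub>R x) - ?e *\<^sub>R T x)"
        by simp
      also have "\<dots> \<le> norm (T (?e *\<^sub>R x)) + norm (?e *\<^sub>R T x)"
        by (rule norm_triangle_ineq4)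
      also have "\<dots> \<le> norm x + norm x"
      proof (rule add_mono)
        have e_le: "norm (?e *\<^sub>R z) \<le> norm z" for z :: "'c::real_normed_vector"
          unfolding norm_scaleR by (rule mult_left_le_one_le[OF norm_ge_zero abs_ge_zero e])
        show "norm (T (?e *\<^sub>R x)) \<le> norm x"
          using le e_le by (rule order_trans)
        show "norm (?e *\<^sub>R T x) \<le> norm x"
          using e_le le by (rule order_trans)
      qed
      finally show ?thesis by simp
    qed
    have "norm (T (t *\<^sub>R x) - t *\<^sub>R T x) \<le> 0"
    proof (rule ccontr)
      assume "\<not> ?thesis"
      then have pos: "0 < norm (T (t *\<^sub>R x) - t *\<^sub>R T x)" by simp
      obtain n where "2 * norm x < real n * norm (T (t *\<^sub>R x) - t *\<^sub>R T x)"
        using ex_less_of_nat_mult[OF pos] by blast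
      with bound[of n] show False
        by simp
    qed
    then show ?thesis by simp
  qed
qed (rule add)

text \<open>The two lenses \<open>ball x (r/2) \<inter> ball y (r/2)\<close> and \<open>ball (f x) (r/2) \<inter> ball (f y) (r/2)\<close>
  are symmetric about the midpoints and correspond to each other under \<open>f\<close>.\<close>

lemma ball_isometry_midpoint:
  fixes f :: "'a::real_normed_vector \<Rightarrow> 'b::real_normed_vector"
  assumes f: "surjective_isometry (ball 0 r) (ball 0 r) f" and f0: "f 0 = 0"
    and x: "norm x < r / 4" and y: "norm y < r / 4"
  shows "f (midpoint x y) = midpoint (f x) (f y)"
proof -
  have iso: "dist (f u) (f v) = dist u v" if "norm u < r" "norm v < r" for u v
    using f that by (simp add: surjective_isometry_def)
  have r: "0 < r" using x norm_ge_zero[of x] by linarith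
  have nf: "norm (f u) = norm u" if "norm u < r" for u
    using iso[of u 0] that r f0 by simp
  \<comment> \<open>As \<open>r / 4 + r / 2 < r\<close>, both lenses lie in the ball on which
    \<open>f\<close> is controlled.\<close>
  have in_ball: "norm w < r" if "norm u < r / 4" "dist u w < r / 2" for u w :: "'c::real_normed_vector"
    using that norm_triangle_ineq4[of u "u - w"] r by (simp add: dist_norm)
  let ?A = "ball x (r / 2) \<inter> ball y (r / 2)"
  let ?B = "ball (f x) (r / 2) \<inter> ball (f y) (r / 2)"
  have fx: "norm (f x) < r / 4" and fy: "norm (f y) < r / 4"
    using x y r by (simp_all add: nf)
  have sym: "u + v - w \<in> ball u s \<inter> ball v s" if "w \<in> ball u s \<inter> ball v s"
    for u v w :: "'c::real_normed_vector" and s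
    using that by (simp add: dist_norm norm_minus_commute)
  have Aiff: "f w \<in> ?B \<longleftrightarrow> w \<in> ?A" if "norm w < r" for w
    using that x y r by (simp add: iso)
  have "f ` ?A = ?B"
  proof (intro equalityI subsetI)
    fix v assume "v \<in> f ` ?A"
    then obtain w where w: "w \<in> ?A" "v = f w" by blast
    then have "norm w < r"
      using in_ball[OF x] by simp
    with w Aiff show "v \<in> ?B" by blast
  next
    fix v assume v: "v \<in> ?B"
    then have "v \<in> ball 0 r"
      using in_ball[OF fx] by auto
    then obtain w where w: "w \<in> ball 0 r" "f w = v"
      using f unfolding surjective_isometry_def by (metis imageE)
    then show "v \<in> f ` ?A"
      using v Aiff[of w] by auto
  qed
  then have "surjective_isometry ?A ?B f"
    using in_ball[OF x] iso by (simp add: surjective_isometry_def)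
  moreover have d: "dist x y < r / 2"
    using norm_triangle_ineq4[of x y] x y by (simp add: dist_norm)
  moreover have "midpoint x y \<in> ?A"
    using d r by (simp add: dist_midpoint)
  ultimately show ?thesis
    using r by (intro surjective_isometry_midpoint[of ?A ?B] sym) (auto simp: dist_commute)
qed

text \<open>Near 0 the midpoint rule makes \<open>f\<close> additive and compatible with halving, so
  \<open>f\<close> extends by scaling the argument down by a power of 2 and the value back
  up.\<close>

lemma surjective_isometry_ball_extends_linearly:
  fixes f :: "'a::real_normed_vector \<Rightarrow> 'b::real_normed_vector"
  assumes f: "surjective_isometry (ball 0 r) (ball 0 r) f" and f0: "f 0 = 0" and r: "0 < r"
  obtains T where "linear T" "surjective_isometry UNIV UNIV T"
    "\<And>x. norm x < r / 8 \<Longrightarrow> T x = f x"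
proof -
  have iso: "dist (f u) (f v) = dist u v" if "norm u < r" "norm v < r" for u v
    using f that by (simp add: surjective_isometry_def)
  have half: "f ((1/2) *\<^sub>R x) = (1/2) *\<^sub>R f x" if "norm x < r / 4" for x
    using ball_isometry_midpoint[OF f f0 that, of 0] r f0 by (simp add: midpoint_def)
  \<comment> \<open>The bound \<open>r / 8\<close> keeps \<open>x + y\<close> below
    \<open>r / 4\<close>, where halving is available; half of \<open>f (x + y)\<close> is then the
    value of \<open>f\<close> at the midpoint.\<close>
  have add: "f (x + y) = f x + f y" if x: "norm x < r / 8" and y: "norm y < r / 8" for x y
  proof -
    have "norm (x + y) < r / 4"
      using norm_triangle_ineq[of x y] x y by linarith
    then have "(1/2) *\<^sub>R f (x + y) = (1/2) *\<^sub>R (f x + f y)"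
      using ball_isometry_midpoint[OF f f0, of x y] half x y r by (simp add: midpoint_def)
    then show ?thesis by simp
  qed
  define g where "g n x = (2 ^ n) *\<^sub>R f ((1 / 2 ^ n) *\<^sub>R x)" for n :: nat and x
  define small where "small n x \<longleftrightarrow> norm x < 2 ^ n * (r / 8)" for n :: nat and x :: 'a
  have small_scaled: "norm ((1 / 2 ^ n) *\<^sub>R x) < r / 8" if "small n x" for n x
    using that by (simp add: small_def field_simps)
  have small_mono: "small n x" if "small m x" "m \<le> n" for m n x
  proof -
    have "(2::real) ^ m * (r / 8) \<le> 2 ^ n * (r / 8)"
      using that(2) r by (intro mult_right_mono) auto
    with that(1) show ?thesis by (simp add: small_def)
  qed
  have ex_small: "\<exists>n. small n x" for x
    using real_arch_pow[of 2 "norm x / (r / 8)"] r by (auto simp: small_def field_simps)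
  have g_Suc: "g (Suc n) x = g n x" if "small n x" for n x
  proof -
    have "norm ((1 / 2 ^ n) *\<^sub>R x) < r / 4"
      using small_scaled[OF that] r by linarith
    from half[OF this] show ?thesis
      by (simp add: g_def)
  qed
  have g_le: "g n x = g m x" if "m \<le> n" "small m x" for m n x
    using that by (induction n rule: dec_induct) (auto simp: g_Suc small_mono)
  \<comment> \<open>The choice of the index is harmless: by \<open>g_le\<close> all indices with
    \<open>small n x\<close> give the same value.\<close>
  define T where "T x = g (SOME n. small n x) x" for x
  have T_eq: "T x = g n x" if "small n x" for n x
    unfolding T_def using g_le that someI[of "\<lambda>n. small n x", OF that] by (metis nle_le)
  have common: "\<exists>n. small n x \<and> small n y \<and> small n z" for x y z
  proof -
    obtain k l m where "small k x" "small l y" "small m z"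
      using ex_small by metis
    then have "small (max k (max l m)) x" "small (max k (max l m)) y" "small (max k (max l m)) z"
      using small_mono by (meson max.cobounded1 max.cobounded2 order_trans)+
    then show ?thesis by blast
  qed
  have T_add: "T (x + y) = T x + T y" for x y
  proof -
    obtain n where n: "small n x" "small n y" "small n (x + y)"
      using common by blast
    then show ?thesis
      by (simp add: T_eq g_def scaleR_add_right add[OF n(1,2)[THEN small_scaled]])
  qed
  have T_iso: "dist (T x) (T y) = dist x y" for x y
  proof -
    obtain n where n: "small n x" "small n y"
      using common by blast
    have "dist (T x) (T y) = 2 ^ n * dist (f ((1 / 2 ^ n) *\<^sub>R x)) (f ((1 / 2 ^ n) *\<^sub>R y))"
      by (simp add: T_eq[OF n(1)] T_eq[OF n(2)] g_def dist_norm flip: scaleR_diff_right)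
    also have "\<dots> = 2 ^ n * dist ((1 / 2 ^ n) *\<^sub>R x) ((1 / 2 ^ n) *\<^sub>R y)"
      using iso[of "(1 / 2 ^ n) *\<^sub>R x" "(1 / 2 ^ n) *\<^sub>R y"]
        small_scaled[OF n(1)] small_scaled[OF n(2)] r by (simp del: norm_scaleR)
    also have "\<dots> = dist x y"
      by (simp add: dist_norm flip: scaleR_diff_right)
    finally show ?thesis .
  qed
  have T_f: "T x = f x" if "norm x < r / 8" for x
    using T_eq[of 0 x] that by (simp add: small_def g_def)
  have T0: "T 0 = 0"
    using T_f[of 0] f0 r by simp
  have "linear T"
    using T_add T_iso[of _ 0] T0 by (intro additive_contraction_imp_linear) auto
  moreover have "y \<in> range T" for y
  proof -
    obtain n where n: "norm y < 2 ^ n * (r / 8)"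
      using real_arch_pow[of 2 "norm y / (r / 8)"] r by (auto simp: field_simps)
    then have y': "norm ((1 / 2 ^ n) *\<^sub>R y) < r / 8"
      by (simp add: field_simps)
    then have "norm ((1 / 2 ^ n) *\<^sub>R y) < r"
      using r by linarith
    then have "(1 / 2 ^ n) *\<^sub>R y \<in> f ` ball 0 r"
      using f by (simp add: surjective_isometry_def)
    then obtain w where w: "norm w < r" "f w = (1 / 2 ^ n) *\<^sub>R y"
      by auto
    \<comment> \<open>\<open>f\<close> fixes 0 and so preserves norms; thus \<open>w\<close> lies
      where \<open>T\<close> agrees with \<open>f\<close>.\<close>
    then have "norm w < r / 8"
      using y' iso[of w 0] f0 r by (simp del: norm_scaleR)
    then have "T w = (1 / 2 ^ n) *\<^sub>R y"
      using w(2) T_f by simp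
    then have "T ((2 ^ n) *\<^sub>R w) = y"
      using \<open>linear T\<close> by (simp add: linear_scale)
    then show ?thesis by blast
  qed
  then have "surjective_isometry UNIV UNIV T"
    using T_iso by (auto simp: surjective_isometry_def)
  ultimately show thesis
    using that T_f by blast
qed

section \<open>From an isometry near the unit to a Jordan isomorphism\<close>

lemma linear_square_imp_jprod:
  fixes T :: "'a::complex_jordan_algebra \<Rightarrow> 'b::complex_jordan_algebra"
  assumes "linear T" and sq: "\<And>x. T (x \<bullet>\<^sub>J x) = T x \<bullet>\<^sub>J T x"
  shows "T (x \<bullet>\<^sub>J y) = T x \<bullet>\<^sub>J T y"
proof -
  have xy: "(x + y) \<bullet>\<^sub>J (x + y) = x \<bullet>\<^sub>J x + y \<bullet>\<^sub>J y + 2 *\<^sub>R (x \<bullet>\<^sub>J y)" for x y :: "'c::complex_jordan_algebra"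
    by (simp add: jprod_linear_simps scaleR_2 jprod_commute)
  have "2 *\<^sub>R T (x \<bullet>\<^sub>J y) = 2 *\<^sub>R (T x \<bullet>\<^sub>J T y)"
    using sq[of "x + y"] by (simp add: xy linear_add[OF assms(1)] linear_scale[OF assms(1)] sq)
  then show ?thesis by simp
qed

text \<open>The squares of \<open>1 + t x\<close> are preserved for all small \<open>t\<close>, and comparing the terms in
  \<open>t\<^sup>2\<close> gives the squares of arbitrary \<open>x\<close>.\<close>

lemma exists_isomorphism_if_isometry_near_1:
  fixes \<Delta> :: "'m::unital_complex_jordan_banach_algebra
    \<Rightarrow> 'n::unital_complex_jordan_banach_algebra"
  assumes \<Delta>: "surjective_isometry M N \<Delta>" "\<Delta> 1 = 1" "preserves_U M \<Delta>"
    and M: "ball 1 r \<subseteq> M" and N: "ball 1 r \<subseteq> N" and r: "0 < r"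
  shows "\<exists>T :: 'm \<Rightarrow> 'n. real_linear_jordan_isomorphism T \<and> surjective_isometry UNIV UNIV T"
proof -
  have iso: "dist (\<Delta> u) (\<Delta> v) = dist u v" if "u \<in> M" "v \<in> M" for u v
    using \<Delta>(1) that by (simp add: surjective_isometry_def)
  have one: "1 \<in> M" using M r by auto
  have in_M: "1 + x \<in> M" if "norm x < r" for x
    using M that by (auto simp: dist_norm subset_iff)
  \<comment> \<open>Translation moves the unit to the origin on both sides.\<close>
  define f where "f x = \<Delta> (1 + x) - 1" for x
  have "f ` ball 0 r = ball 0 r"
  proof (intro equalityI subsetI)
    fix v assume "v \<in> f ` ball 0 r"
    then obtain x where x: "norm x < r" "v = f x" by auto
    then show "v \<in> ball 0 r"
      using iso[OF in_M[OF x(1)] one] \<Delta>(2) by (simp add: f_def dist_norm norm_minus_commute)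
  next
    fix v :: 'n assume v: "v \<in> ball 0 r"
    then have "1 + v \<in> N" using N by (auto simp: dist_norm subset_iff)
    \<comment> \<open>The preimage is only known to lie in \<open>M\<close>; preservation of the
      distance to 1 places it in the ball.\<close>
    then obtain w where w: "w \<in> M" "\<Delta> w = 1 + v"
      using \<Delta>(1) unfolding surjective_isometry_def by (metis imageE)
    then have "norm (w - 1) < r"
      using iso[OF w(1) one] v \<Delta>(2) by (simp add: dist_norm)
    moreover have "f (w - 1) = v" using w(2) by (simp add: f_def)
    ultimately show "v \<in> f ` ball 0 r" by force
  qed
  then have "surjective_isometry (ball 0 r) (ball 0 r) f"
    using iso[OF in_M in_M] by (auto simp: surjective_isometry_def f_def dist_norm)
  moreover have "f 0 = 0" using \<Delta>(2) by (simp add: f_def)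
  ultimately obtain T where T: "linear T" "surjective_isometry UNIV UNIV T"
    "\<And>x. norm x < r / 8 \<Longrightarrow> T x = f x"
    using surjective_isometry_ball_extends_linearly r by blast
  have \<Delta>_T: "\<Delta> (1 + x) = 1 + T x" if "norm x < r / 8" for x
    using T(3)[OF that] by (simp add: f_def)
  have "T (x \<bullet>\<^sub>J x) = T x \<bullet>\<^sub>J T x" for x
  proof -
    \<comment> \<open>A positive \<open>t\<close> is sought for which both
      \<open>1 + t *\<^sub>R x\<close> and its square are so close to 1 that \<open>\<Delta>\<close>
      is given by \<open>T\<close> there.\<close>
    have "((\<lambda>t. norm (t *\<^sub>R x)) \<longlongrightarrow> norm (0 *\<^sub>R x)) (at_right 0)"
      and "((\<lambda>t. norm (2 *\<^sub>R t *\<^sub>R x + t\<^sup>2 *\<^sub>R (x \<bullet>\<^sub>J x)))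
        \<longlongrightarrow> norm (2 *\<^sub>R (0::real) *\<^sub>R x + 0\<^sup>2 *\<^sub>R (x \<bullet>\<^sub>J x))) (at_right 0)"
      by (intro tendsto_intros)+
    then have "\<forall>\<^sub>F t in at_right (0::real). norm (t *\<^sub>R x) < r / 8"
      and "\<forall>\<^sub>F t in at_right 0. norm (2 *\<^sub>R t *\<^sub>R x + t\<^sup>2 *\<^sub>R (x \<bullet>\<^sub>J x)) < r / 8"
      using r by (auto dest!: order_tendstoD(2)[where a = "r / 8"] simp del: norm_scaleR)
    then have "\<forall>\<^sub>F t in at_right (0::real). 0 < t \<and> norm (t *\<^sub>R x) < r / 8
        \<and> norm (2 *\<^sub>R t *\<^sub>R x + t\<^sup>2 *\<^sub>R (x \<bullet>\<^sub>J x)) < r / 8"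
      using eventually_at_right_less[of "0::real"] by eventually_elim auto
    then obtain t :: real where t: "0 < t" "norm (t *\<^sub>R x) < r / 8"
      "norm (2 *\<^sub>R t *\<^sub>R x + t\<^sup>2 *\<^sub>R (x \<bullet>\<^sub>J x)) < r / 8"
      using eventually_happens trivial_limit_at_right_real by blast
    have square: "U_op (1 + t *\<^sub>R u) 1 = 1 + (2 *\<^sub>R t *\<^sub>R u + t\<^sup>2 *\<^sub>R (u \<bullet>\<^sub>J u))"
      for u :: "'c::unital_complex_jordan_banach_algebra"
      unfolding scaleR_2
      by (simp add: U_op_1_right jprod_linear_simps one_jprod jprod_one power2_eq_square
          scaleR_add_right add.assoc)
    have "1 + t *\<^sub>R x \<in> M" using t(2) r by (intro in_M) auto
    then have "\<Delta> (U_op (1 + t *\<^sub>R x) 1) = U_op (\<Delta> (1 + t *\<^sub>R x)) 1"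
      using \<Delta>(2,3) one by (simp add: preserves_U_def)
    then have "1 + T (2 *\<^sub>R t *\<^sub>R x + t\<^sup>2 *\<^sub>R (x \<bullet>\<^sub>J x)) = U_op (1 + t *\<^sub>R T x) 1"
      by (simp only: square \<Delta>_T[OF t(2)] \<Delta>_T[OF t(3)] linear_scale[OF T(1)])
    \<comment> \<open>The unit and the terms linear in \<open>t\<close> agree on both sides and
      cancel.\<close>
    then have "t\<^sup>2 *\<^sub>R T (x \<bullet>\<^sub>J x) = t\<^sup>2 *\<^sub>R (T x \<bullet>\<^sub>J T x)"
      by (simp add: square linear_add[OF T(1)] linear_scale[OF T(1)])
    then show ?thesis using t(1) by simp
  qed
  then have "T (x \<bullet>\<^sub>J y) = T x \<bullet>\<^sub>J T y" for x y
    by (rule linear_square_imp_jprod[OF T(1)])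
  moreover have "bij T"
    using T(2) by (auto simp: surjective_isometry_def bij_def inj_def) (metis dist_eq_0_iff)
  ultimately show ?thesis
    using T by (auto simp: real_linear_jordan_isomorphism_def)
qed

section \<open>Jordan isomorphisms restricted to the invertible elements\<close>

lemma is_jinverse_image:
  assumes "\<And>x y. T (x \<bullet>\<^sub>J y) = T x \<bullet>\<^sub>J T y" "T 1 = 1" "is_jinverse a b"
  shows "is_jinverse (T a) (T b)"
  using assms(3) unfolding is_jinverse_def by (metis assms(1,2))

lemma isomorphism_on_invertibles:
  fixes T :: "'m::unital_complex_jordan_banach_algebra
    \<Rightarrow> 'n::unital_complex_jordan_banach_algebra"
  assumes "real_linear_jordan_isomorphism T" "surjective_isometry UNIV UNIV T"
  shows "surjective_isometry invertibles invertibles T" "T 1 = 1" "preserves_U invertibles T"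
proof -
  have lin: "linear T" and T: "bij T" and mult: "T (x \<bullet>\<^sub>J y) = T x \<bullet>\<^sub>J T y" for x y
    using assms(1) by (auto simp: real_linear_jordan_isomorphism_def)
  have inv: "inv T (T x) = x" "T (inv T y) = y" for x y
    using T by (simp_all add: bij_is_inj bij_is_surj surj_f_inv_f)
  show T1: "T 1 = 1"
    \<comment> \<open>By surjectivity 1 is the image of \<open>inv T 1\<close>, and multiplying it
      by \<open>T 1\<close> gives both 1 and \<open>T 1\<close>.\<close>
    using mult[of 1 "inv T 1"] by (simp add: inv one_jprod jprod_one)
  have mult': "inv T (x \<bullet>\<^sub>J y) = inv T x \<bullet>\<^sub>J inv T y" for x y
    by (metis inv mult)
  have T1': "inv T 1 = 1"
    by (metis T1 inv(1))
  have "T ` invertibles = invertibles"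
  proof (intro equalityI subsetI)
    fix y assume "y \<in> T ` invertibles"
    then show "y \<in> invertibles"
      using is_jinverse_image[OF mult T1] by (auto simp: invertibles_def)
  next
    fix y :: 'n assume "y \<in> invertibles"
    then have "inv T y \<in> invertibles"
      using is_jinverse_image[OF mult' T1'] by (auto simp: invertibles_def)
    then show "y \<in> T ` invertibles"
      by (metis inv(2) imageI)
  qed
  then show "surjective_isometry invertibles invertibles T"
    using assms(2) by (simp add: surjective_isometry_def)
  show "preserves_U invertibles T"
    by (simp add: preserves_U_def U_op_def mult linear_diff[OF lin] linear_scale[OF lin])
qed

section \<open>The implications between the three statements\<close>

lemma invertibles_quadratic_clopen:
  "quadratic_subset invertibles" "clopen_in invertibles invertibles"
  "closed_powers_inverses invertibles"
  using one_invertibles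
  by (auto simp: quadratic_subset_def U_op_invertibles clopen_in_def closed_powers_inverses_def
      jpower_invertibles jinverse_invertibles)

text \<open>Both sets contain the unit and are relatively open, so each contains a ball around it;
  the smaller radius serves for both.\<close>

lemma exists_isomorphism_if_clopen_quadratic_isometry:
  fixes \<Delta> :: "'m::unital_complex_jordan_banach_algebra
    \<Rightarrow> 'n::unital_complex_jordan_banach_algebra"
  assumes "quadratic_subset M" "clopen_in invertibles M" "closed_powers_inverses M"
    and "quadratic_subset N" "clopen_in invertibles N" "closed_powers_inverses N"
    and \<Delta>: "surjective_isometry M N \<Delta>" "\<Delta> 1 = 1" "preserves_U M \<Delta>"
  shows "\<exists>T :: 'm \<Rightarrow> 'n. real_linear_jordan_isomorphism T \<and> surjective_isometry UNIV UNIV T"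
proof -
  obtain r where r: "0 < r" "ball 1 r \<subseteq> M"
    using assms ball_subset_if_openin_invertibles one_in_quadratic_subset
    unfolding clopen_in_def by blast
  obtain s where s: "0 < s" "ball 1 s \<subseteq> N"
    using assms ball_subset_if_openin_invertibles one_in_quadratic_subset
    unfolding clopen_in_def by blast
  have "ball 1 (min r s) \<subseteq> M" "ball 1 (min r s) \<subseteq> N"
    using r s by auto
  with r s show ?thesis
    by (intro exists_isomorphism_if_isometry_near_1[OF \<Delta>, of "min r s"]) auto
qed

theorem corollary3p17:
  "((\<exists>T :: 'm::unital_complex_jordan_banach_algebra \<Rightarrow>
          'n::unital_complex_jordan_banach_algebra.
        real_linear_jordan_isomorphism T \<and> surjective_isometry UNIV UNIV T)
    \<longleftrightarrow>
    (\<exists>(\<MM> :: 'm set) (\<NN> :: 'n set).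
        quadratic_subset \<MM> \<and> clopen_in invertibles \<MM> \<and> closed_powers_inverses \<MM> \<and>
        quadratic_subset \<NN> \<and> clopen_in invertibles \<NN> \<and> closed_powers_inverses \<NN> \<and>
        (\<exists>\<Delta> :: 'm \<Rightarrow> 'n.
            surjective_isometry \<MM> \<NN> \<Delta> \<and> \<Delta> 1 = 1 \<and> preserves_U \<MM> \<Delta>)))
   \<and>
   ((\<exists>(\<MM> :: 'm set) (\<NN> :: 'n set).
        quadratic_subset \<MM> \<and> clopen_in invertibles \<MM> \<and> closed_powers_inverses \<MM> \<and>
        quadratic_subset \<NN> \<and> clopen_in invertibles \<NN> \<and> closed_powers_inverses \<NN> \<and>
        (\<exists>\<Delta> :: 'm \<Rightarrow> 'n.
            surjective_isometry \<MM> \<NN> \<Delta> \<and> \<Delta> 1 = 1 \<and> preserves_U \<MM> \<Delta>))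
    \<longleftrightarrow>
    (\<exists>\<Delta> :: 'm \<Rightarrow> 'n.
        surjective_isometry invertibles invertibles \<Delta> \<and> \<Delta> 1 = 1 \<and>
        preserves_U invertibles \<Delta>))"
  (is "(?a \<longleftrightarrow> ?b) \<and> (?b \<longleftrightarrow> ?c)")
proof -
  have "?a \<Longrightarrow> ?c"
    using isomorphism_on_invertibles by blast
  moreover have "?c \<Longrightarrow> ?b"
    by (rule exI[of _ "invertibles :: 'm set"], rule exI[of _ "invertibles :: 'n set"])
      (simp add: invertibles_quadratic_clopen)
  moreover have "?b \<Longrightarrow> ?a"
    using exists_isomorphism_if_clopen_quadratic_isometry by blast
  ultimately show ?thesis
    by blast
qed

end
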